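(* Let $n,m\in\mathbb{N}$, let $a=(a_1,\dots,a_n)^{T}:I\to\mathbb{R}^n$ be an $(m-1)$-times continuously differentiable function, and let $f:I\to\mathbb{R}^n$ be a fundamental system of solutions of the differential equation $y^{(n)}=a_1y^{(n-1)}+\dots+a_ny$ on $I$. Let $X_a:I\to\mathbb{R}^{n\times n}$ be the matrix-valued function with columns $$X_a:=\begin{pmatrix}a&e_1&\dots&e_{n-1}\end{pmatrix}.$$ Then, for every $k=(k_1,\dots,k_n)\in\mathbb{N}_0^n$ with $\max(k_1,\dots,k_n)\leq m+n-1$, $$W_f^k=W_f\begin{vmatrix}B_{\ell_1}\big(X_a,\dots,X_a^{(\ell_1-1)}\big)e_{n+\ell_1-k_1}&\dots&B_{\ell_n}\big(X_a,\dots,X_a^{(\ell_n-1)}\big)e_{n+\ell_n-k_n}\end{vmatrix}$$ holds on $I$, where $\ell_i:=(k_i-n+1)^+$ for $i\in\{1,\dots,n\}$.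
   Context: $\mathbb{N}$ and $\mathbb{N}_0$ denote the positive and the nonnegative integers; $I$ is a nonempty open real interval; $x^+:=\max(x,0)$; $e_1,\dots,e_n$ is the standard basis of $\mathbb{R}^n$; vectors are column vectors. A function $f=(f_1,\dots,f_n)^T:I\to\mathbb{R}^n$ is a fundamental system of solutions of an $n$th-order homogeneous linear differential equation if its components $f_1,\dots,f_n$ are linearly independent solutions on $I$ (a basis of the solution space). For a sufficiently smooth $f:I\to\mathbb{R}^n$ and $k=(k_1,\dots,k_n)\in\mathbb{N}_0^n$, the generalized Wronskian $W_f^k:I\to\mathbb{R}$ is the determinant $W_f^k:=\begin{vmatrix}f^{(k_1)}&\dots&f^{(k_n)}\end{vmatrix}$ of the matrix with columns $f^{(k_1)},\dots,f^{(k_n)}$, and the Wronskian is $W_f:=W_f^{(n-1,n-2,\dots,0)}=\begin{vmatrix}f^{(n-1)}&\dots&f'&f\end{vmatrix}$. The noncommutative complete Bell polynomials $B_m:(\mathbb{R}^{n\times n})^m\to\mathbb{R}^{n\times n}$ are defined recursively by $B_0:=\mathbb{I}_n$ (the $n\times n$ unit matrix) and $$B_{m+1}(X_1,\dots,X_{m+1}):=\sum_{j=0}^m\binom{m}{j}B_j(X_1,\dots,X_j)X_{m+1-j}.$$ For a matrix-valued function $X$, $B_j\big(X,\dots,X^{(j-1)}\big)$ means $B_j$ evaluated at $X$ and its derivatives up to order $j-1$; for $j=0$ it is $\mathbb{I}_n$. *)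

theory Defs
  imports "HOL-Analysis.Derivative" "Jordan_Normal_Form.Determinant"
begin

(* Jordan_Normal_Form vectors and matrices carry no topology, so derivatives are taken entrywise.
   All functions below are only meaningful on an open set I; there the iterated deriv
   depends on the values on I only. Indices of vectors and matrices start at 0: the
   mathematical entry a_i is a $ (i - 1) and the basis vector e_j is unit_vec n (j - 1). *)

definition times_differentiable_on :: "nat \<Rightarrow> (real \<Rightarrow> real) \<Rightarrow> real set \<Rightarrow> bool" where
  "times_differentiable_on k g I \<longleftrightarrow>
     (\<forall>j<k. \<forall>t\<in>I. (deriv ^^ j) g differentiable (at t))"

definition times_cont_differentiable_on :: "nat \<Rightarrow> (real \<Rightarrow> real) \<Rightarrow> real set \<Rightarrow> bool" where
  "times_cont_differentiable_on k g I \<longleftrightarrow>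
     times_differentiable_on k g I \<and> continuous_on I ((deriv ^^ k) g)"

definition vec_deriv :: "nat \<Rightarrow> (real \<Rightarrow> real vec) \<Rightarrow> real \<Rightarrow> real vec" where
  "vec_deriv k f t = vec (dim_vec (f t)) (\<lambda>i. (deriv ^^ k) (\<lambda>s. f s $ i) t)"

definition mat_deriv :: "nat \<Rightarrow> (real \<Rightarrow> real mat) \<Rightarrow> real \<Rightarrow> real mat" where
  "mat_deriv k X t =
     mat (dim_row (X t)) (dim_col (X t)) (\<lambda>(i, j). (deriv ^^ k) (\<lambda>s. X s $$ (i, j)) t)"

(* y solves y^(n) = a_1 y^(n-1) + ... + a_n y on I *)
definition solves_linear_ode ::
  "nat \<Rightarrow> (real \<Rightarrow> real vec) \<Rightarrow> real set \<Rightarrow> (real \<Rightarrow> real) \<Rightarrow> bool" where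
  "solves_linear_ode n a I y \<longleftrightarrow>
     times_differentiable_on n y I \<and>
     (\<forall>t\<in>I. (deriv ^^ n) y t = (\<Sum>i<n. a t $ i * (deriv ^^ (n - 1 - i)) y t))"

definition fundamental_system ::
  "nat \<Rightarrow> (real \<Rightarrow> real vec) \<Rightarrow> real set \<Rightarrow> (real \<Rightarrow> real vec) \<Rightarrow> bool" where
  "fundamental_system n a I f \<longleftrightarrow>
     (\<forall>t\<in>I. f t \<in> carrier_vec n) \<and>
     (\<forall>i<n. solves_linear_ode n a I (\<lambda>t. f t $ i)) \<and>
     (\<forall>c. (\<forall>t\<in>I. (\<Sum>i<n. c i * f t $ i) = 0) \<longrightarrow> (\<forall>i<n. c i = 0))"

definition gen_wronskian :: "nat \<Rightarrow> nat vec \<Rightarrow> (real \<Rightarrow> real vec) \<Rightarrow> real \<Rightarrow> real" where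
  "gen_wronskian n k f t = det (mat_of_cols n (map (\<lambda>i. vec_deriv (k $ i) f t) [0..<n]))"

definition wronskian :: "nat \<Rightarrow> (real \<Rightarrow> real vec) \<Rightarrow> real \<Rightarrow> real" where
  "wronskian n f = gen_wronskian n (vec n (\<lambda>i. n - 1 - i)) f"

(* nc_bell n m X is B_m(X_1, ..., X_m) for n x n matrices; the sequence X is read from
   index 1 on, and only X 1, ..., X m matter. The sum of matrices is formed entrywise. *)
context
  notes sum.cong [fundef_cong]
begin

fun nc_bell :: "nat \<Rightarrow> nat \<Rightarrow> (nat \<Rightarrow> real mat) \<Rightarrow> real mat" where
  "nc_bell n 0 X = 1\<^sub>m n"
| "nc_bell n (Suc m) X =
     mat n n (\<lambda>rc. \<Sum>j\<le>m. (of_nat (m choose j) \<cdot>\<^sub>m (nc_bell n j X * X (m + 1 - j))) $$ rc)"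

end

(* columns a, e_1, ..., e_{n-1} *)
definition companion_fun :: "nat \<Rightarrow> (real \<Rightarrow> real vec) \<Rightarrow> real \<Rightarrow> real mat" where
  "companion_fun n a t = mat_of_cols n (a t # map (unit_vec n) [0..<n - 1])"

end

theory Submission
  imports Defs
begin

text \<open>
  Let \<open>F\<close> be the matrix with columns \<open>f^(n-1), ..., f', f\<close>, so that \<open>wronskian n f = det F\<close>.
  The differential equation says exactly that \<open>F' = F X\<close> with \<open>X\<close> the companion matrix: multiplying
  \<open>F\<close> by the column \<open>a\<close> yields \<open>f^(n)\<close>, and multiplying it by \<open>e_1, ..., e_{n-1}\<close> only shifts its
  columns. Differentiating \<open>F' = F X\<close> another \<open>l\<close> times by the Leibniz rule gives
  \<open>F^(l+1) = \<Sum>j\<le>l. (l choose j) F^(j) X^(l-j)\<close>. If \<open>F^(j) = F B_j\<close> for all \<open>j \<le> l\<close>, the left factor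
  \<open>F\<close> comes out of the sum and what remains is the recursion of the Bell polynomials; hence
  \<open>F^(l) = F B_l\<close> as long as \<open>X\<close> is \<open>l - 1\<close> times differentiable
  (\<open>higher_deriv_of_linear_system\<close>, stated for one row of \<open>F\<close>).

  Every derivative \<open>f^(k)\<close> is a column of some \<open>F^(l)\<close>: of \<open>F\<close> itself for \<open>k < n\<close>, and the first
  column of \<open>F^(k-n+1)\<close> otherwise. Thus the matrix with columns \<open>f^(k_i)\<close> is \<open>F\<close> times the matrix
  with columns \<open>B_{l_i} e_{n+l_i-k_i}\<close>, and the determinant is multiplicative.

  Since \<open>deriv\<close> is total, each rule for iterated derivatives has to be accompanied by the existence
  of the derivatives. For \<open>F\<close> this is a bootstrap: \<open>F' = F X\<close> is as smooth as \<open>F\<close> and \<open>X\<close> are, so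
  \<open>F\<close> is once more differentiable than \<open>X\<close>.
\<close>

section \<open>Iterated derivatives on open sets\<close>

lemma has_deriv_if_times_differentiable_on:
  assumes "times_differentiable_on k g I" "j < k" "t \<in> I"
  shows "((deriv ^^ j) g has_real_derivative (deriv ^^ Suc j) g t) (at t)"
  using assms by (simp add: times_differentiable_on_def DERIV_deriv_iff_real_differentiable)

lemma times_differentiable_on_mono:
  "times_differentiable_on k g I \<Longrightarrow> j \<le> k \<Longrightarrow> times_differentiable_on j g I"
  by (auto simp: times_differentiable_on_def)

lemma times_differentiable_on_Suc_iff:
  "times_differentiable_on (Suc k) g I \<longleftrightarrow>
     (\<forall>t\<in>I. g differentiable (at t)) \<and> times_differentiable_on k (deriv g) I"
  by (auto simp: times_differentiable_on_def All_less_Suc2 funpow_Suc_right comp_def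
      simp del: funpow.simps(2))

lemma higher_deriv_cong:
  assumes "open I" "\<And>s. s \<in> I \<Longrightarrow> g s = h s" "t \<in> I"
  shows "(deriv ^^ k) g t = (deriv ^^ k) h t"
  using assms(3)
proof (induction k arbitrary: t)
  case 0
  then show ?case using assms(2) by simp
next
  case (Suc k)
  have "eventually (\<lambda>s. (deriv ^^ k) g s = (deriv ^^ k) h s) (nhds t)"
    using Suc assms(1) by (auto simp: eventually_nhds)
  then show ?case by (auto intro: deriv_cong_ev)
qed

text \<open>
  This turns a formula \<open>G j\<close> for the derivatives of \<open>g\<close>, verified by differentiating one step at a
  time, into both facts that one wants to know about iterated derivatives: their existence and their
  values.
\<close>
lemma higher_deriv_from_steps:
  assumes "open I" and base: "\<And>t. t \<in> I \<Longrightarrow> g t = G 0 t"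
    and step: "\<And>j t. j < k \<Longrightarrow> t \<in> I \<Longrightarrow> (G j has_real_derivative G (Suc j) t) (at t)"
  shows "times_differentiable_on k g I" "t \<in> I \<Longrightarrow> (deriv ^^ k) g t = G k t"
proof -
  have val: "(deriv ^^ j) g t = G j t" if "j \<le> k" "t \<in> I" for j t
    using that
  proof (induction j arbitrary: t)
    case 0
    then show ?case using base by simp
  next
    case (Suc j)
    have "((deriv ^^ j) g has_real_derivative G (Suc j) t) (at t)"
      using Suc by (intro has_field_derivative_transform_within_open[OF step \<open>open I\<close>]) auto
    then show ?case by (simp add: DERIV_imp_deriv)
  qed
  show "times_differentiable_on k g I"
    unfolding times_differentiable_on_def
  proof (intro allI impI ballI)
    fix j t assume "j < k" "t \<in> I"
    then have "((deriv ^^ j) g has_real_derivative G (Suc j) t) (at t)"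
      using val by (intro has_field_derivative_transform_within_open[OF step \<open>open I\<close>]) auto
    then show "(deriv ^^ j) g differentiable (at t)"
      by (auto simp: real_differentiable_def)
  qed
  show "t \<in> I \<Longrightarrow> (deriv ^^ k) g t = G k t" using val by simp
qed

lemma times_differentiable_on_cong:
  assumes "open I" "\<And>s. s \<in> I \<Longrightarrow> g s = h s" "times_differentiable_on k h I"
  shows "times_differentiable_on k g I"
  using assms by (intro higher_deriv_from_steps(1)[where G = "\<lambda>j. (deriv ^^ j) h"])
    (auto intro: has_deriv_if_times_differentiable_on simp del: funpow.simps(2))

lemma times_differentiable_on_const:
  assumes "open I"
  shows "times_differentiable_on k (\<lambda>s. c) I"
  using assms by (intro higher_deriv_from_steps(1)[where G = "\<lambda>j s. if j = 0 then c else 0"]) auto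

lemma
  assumes "open I" "\<And>d. d \<in> D \<Longrightarrow> times_differentiable_on k (g d) I"
  shows times_differentiable_on_sum: "times_differentiable_on k (\<lambda>s. \<Sum>d\<in>D. g d s) I"
    and higher_deriv_sum:
      "t \<in> I \<Longrightarrow> (deriv ^^ k) (\<lambda>s. \<Sum>d\<in>D. g d s) t = (\<Sum>d\<in>D. (deriv ^^ k) (g d) t)"
proof -
  note steps = higher_deriv_from_steps
    [OF \<open>open I\<close>, where g = "\<lambda>s. \<Sum>d\<in>D. g d s" and G = "\<lambda>j s. \<Sum>d\<in>D. (deriv ^^ j) (g d) s"]
  have step: "((\<lambda>s. \<Sum>d\<in>D. (deriv ^^ j) (g d) s) has_real_derivative
      (\<Sum>d\<in>D. (deriv ^^ Suc j) (g d) t)) (at t)" if "j < k" "t \<in> I" for j t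
    using that assms(2) by (intro DERIV_sum has_deriv_if_times_differentiable_on)
  show "times_differentiable_on k (\<lambda>s. \<Sum>d\<in>D. g d s) I"
    by (rule steps) (auto simp del: funpow.simps(2) intro: step)
  show "t \<in> I \<Longrightarrow> (deriv ^^ k) (\<lambda>s. \<Sum>d\<in>D. g d s) t = (\<Sum>d\<in>D. (deriv ^^ k) (g d) t)"
    by (rule steps) (auto simp del: funpow.simps(2) intro: step)
qed

text \<open>
  The induction step of the Leibniz rule, with \<open>A j j'\<close> in the place of \<open>u^(j) v^(j')\<close>.
\<close>
lemma sum_binomial_pascal:
  fixes A :: "nat \<Rightarrow> nat \<Rightarrow> real"
  shows "(\<Sum>j\<le>k. real (k choose j) * (A (Suc j) (k - j) + A j (Suc (k - j)))) =
    (\<Sum>j\<le>Suc k. real (Suc k choose j) * A j (Suc k - j))"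
proof -
  have "(\<Sum>j\<le>k. real (k choose j) * A j (Suc (k - j))) =
      (\<Sum>j\<le>Suc k. real (k choose j) * A j (Suc k - j))"
    by (simp add: Suc_diff_le)
  also have "\<dots> = A 0 (Suc k) + (\<Sum>j\<le>k. real (k choose Suc j) * A (Suc j) (k - j))"
    by (subst sum.atMost_Suc_shift) simp
  finally have "(\<Sum>j\<le>k. real (k choose j) * A j (Suc (k - j))) =
      A 0 (Suc k) + (\<Sum>j\<le>k. real (k choose Suc j) * A (Suc j) (k - j))" .
  then show ?thesis
    by (subst sum.atMost_Suc_shift) (simp add: algebra_simps sum.distrib)
qed

text \<open>
  The Leibniz rule for functions that are differentiable only finitely often: the formula for the
  \<open>i\<close>-th derivative can be differentiated term by term as long as \<open>i < k\<close>, because every factor in it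
  then has order at most \<open>i\<close>.
\<close>
lemma
  assumes "open I" "times_differentiable_on k u I" "times_differentiable_on k v I"
  shows times_differentiable_on_mult: "times_differentiable_on k (\<lambda>s. u s * v s) I"
    and higher_deriv_mult: "t \<in> I \<Longrightarrow> (deriv ^^ k) (\<lambda>s. u s * v s) t =
      (\<Sum>j\<le>k. real (k choose j) * ((deriv ^^ j) u t * (deriv ^^ (k - j)) v t))"
proof -
  define G where
    "G = (\<lambda>i s. \<Sum>j\<le>i. real (i choose j) * ((deriv ^^ j) u s * (deriv ^^ (i - j)) v s))"
  have step: "(G i has_real_derivative G (Suc i) t) (at t)" if i: "i < k" and t: "t \<in> I" for i t
  proof -
    have "(G i has_real_derivative (\<Sum>j\<le>i. real (i choose j) *
        ((deriv ^^ Suc j) u t * (deriv ^^ (i - j)) v t +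
         (deriv ^^ j) u t * (deriv ^^ Suc (i - j)) v t))) (at t)"
      unfolding G_def
    proof (intro DERIV_sum DERIV_cmult)
      fix j assume "j \<in> {..i}"
      then have "((deriv ^^ j) u has_real_derivative (deriv ^^ Suc j) u t) (at t)"
        and "((deriv ^^ (i - j)) v has_real_derivative (deriv ^^ Suc (i - j)) v t) (at t)"
        using i t assms by (auto intro!: has_deriv_if_times_differentiable_on simp del: funpow.simps)
      from DERIV_mult[OF this]
      show "((\<lambda>s. (deriv ^^ j) u s * (deriv ^^ (i - j)) v s) has_real_derivative
          (deriv ^^ Suc j) u t * (deriv ^^ (i - j)) v t +
          (deriv ^^ j) u t * (deriv ^^ Suc (i - j)) v t) (at t)"
        by (simp add: mult.commute del: funpow.simps)
    qed
    then show ?thesis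
      unfolding G_def
      using sum_binomial_pascal[of i "\<lambda>j j'. (deriv ^^ j) u t * (deriv ^^ j') v t"]
      by (simp only:)
  qed
  have base: "u s * v s = G 0 s" for s by (simp add: G_def)
  show "times_differentiable_on k (\<lambda>s. u s * v s) I"
    by (rule higher_deriv_from_steps(1)[OF \<open>open I\<close> base step])
  show "t \<in> I \<Longrightarrow> (deriv ^^ k) (\<lambda>s. u s * v s) t =
      (\<Sum>j\<le>k. real (k choose j) * ((deriv ^^ j) u t * (deriv ^^ (k - j)) v t))"
    using higher_deriv_from_steps(2)[OF \<open>open I\<close> base step] by (simp add: G_def)
qed

section \<open>Linear systems and Bell polynomials\<close>

lemma nc_bell_carrier: "nc_bell n m X \<in> carrier_mat n n"
  by (cases m) auto

lemma nc_bell_Suc_entry: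
  assumes X: "\<And>j. X j \<in> carrier_mat n n" and "r < n" "c < n"
  shows "nc_bell n (Suc m) X $$ (r, c) =
    (\<Sum>j\<le>m. real (m choose j) * (\<Sum>e<n. nc_bell n j X $$ (r, e) * X (m + 1 - j) $$ (e, c)))"
proof -
  have "(real (m choose j) \<cdot>\<^sub>m (nc_bell n j X * X (m + 1 - j))) $$ (r, c) =
      real (m choose j) * (\<Sum>e<n. nc_bell n j X $$ (r, e) * X (m + 1 - j) $$ (e, c))" for j
    using carrier_matD[OF X[of "m + 1 - j"]] carrier_matD[OF nc_bell_carrier[of n j X]] assms(2,3)
    by (auto simp: scalar_prod_def atLeast0LessThan intro!: sum.cong)
  then show ?thesis using assms(2,3) by simp
qed

text \<open>
  The equation \<open>F' = F X\<close> holds row by row, and no row involves another; \<open>y 0, ..., y (n-1)\<close> are the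
  entries of a single row of \<open>F\<close>.
\<close>
locale linear_system =
  fixes n p :: nat and I :: "real set" and X :: "real \<Rightarrow> real mat" and y :: "nat \<Rightarrow> real \<Rightarrow> real"
  assumes open_I: "open I"
    and X_carrier: "\<And>t. X t \<in> carrier_mat n n"
    and X_smooth: "\<And>d c. d < n \<Longrightarrow> c < n \<Longrightarrow> times_differentiable_on p (\<lambda>s. X s $$ (d, c)) I"
    and y_deriv: "\<And>c t. c < n \<Longrightarrow> t \<in> I \<Longrightarrow>
      (y c has_real_derivative (\<Sum>d<n. y d t * X t $$ (d, c))) (at t)"
begin

lemma deriv_y: "c < n \<Longrightarrow> t \<in> I \<Longrightarrow> deriv (y c) t = (\<Sum>d<n. y d t * X t $$ (d, c))"
  using y_deriv by (rule DERIV_imp_deriv)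

text \<open>
  If all components are \<open>l\<close> times differentiable and \<open>l \<le> p\<close>, then so are the right-hand sides of
  the system, which are the derivatives of the components.
\<close>
lemma solution_smooth:
  assumes "l \<le> Suc p" "c < n"
  shows "times_differentiable_on l (y c) I"
  using assms
proof (induction l arbitrary: c)
  case 0
  then show ?case by (simp add: times_differentiable_on_def)
next
  case (Suc l)
  have sum: "times_differentiable_on l (\<lambda>s. \<Sum>d<n. y d s * X s $$ (d, c)) I"
    using Suc open_I times_differentiable_on_mono[OF X_smooth]
    by (intro times_differentiable_on_sum times_differentiable_on_mult) auto
  have "times_differentiable_on l (deriv (y c)) I"
    by (rule times_differentiable_on_cong[OF open_I deriv_y[OF \<open>c < n\<close>] sum])
  moreover have "y c differentiable (at t)" if "t \<in> I" for t
    using y_deriv[OF \<open>c < n\<close> that] by (auto simp: real_differentiable_def)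
  ultimately show ?case by (simp add: times_differentiable_on_Suc_iff)
qed

lemma higher_deriv_of_linear_system:
  assumes "l \<le> Suc p" "c < n" "t \<in> I"
  shows "(deriv ^^ l) (y c) t =
    (\<Sum>d<n. y d t * nc_bell n l (\<lambda>j. mat_deriv (j - 1) X t) $$ (d, c))"
  using assms(1,2)
proof (induction l arbitrary: c rule: less_induct)
  case (less l)
  let ?B = "\<lambda>l. nc_bell n l (\<lambda>j. mat_deriv (j - 1) X t)"
  have D_carrier: "mat_deriv j X t \<in> carrier_mat n n" for j
    using X_carrier[of t] by (simp add: mat_deriv_def)
  have D_entry: "mat_deriv j X t $$ (d, e) = (deriv ^^ j) (\<lambda>s. X s $$ (d, e)) t"
    if "d < n" "e < n" for j d e
    using X_carrier[of t] that by (simp add: mat_deriv_def)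
  show ?case
  proof (cases l)
    case 0
    have "(\<Sum>d<n. y d t * 1\<^sub>m n $$ (d, c)) = (\<Sum>d<n. if d = c then y d t else 0)"
      using less.prems by (intro sum.cong) auto
    then show ?thesis using 0 less.prems by simp
  next
    case (Suc q)
    with less.prems have q: "q \<le> p" by simp
    have y: "times_differentiable_on q (y d) I" if "d < n" for d
      using solution_smooth[of q d] that q by simp
    have x: "times_differentiable_on q (\<lambda>s. X s $$ (d, c)) I" if "d < n" for d
      using times_differentiable_on_mono[OF X_smooth] that q less.prems by blast
    have "(deriv ^^ l) (y c) t = (deriv ^^ q) (deriv (y c)) t"
      by (simp add: Suc funpow_Suc_right del: funpow.simps)
    also have "\<dots> = (deriv ^^ q) (\<lambda>s. \<Sum>d<n. y d s * X s $$ (d, c)) t"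
      using deriv_y less.prems open_I assms(3) by (intro higher_deriv_cong) auto
    also have "\<dots> = (\<Sum>d<n. (deriv ^^ q) (\<lambda>s. y d s * X s $$ (d, c)) t)"
      using x y open_I assms(3)
      by (intro higher_deriv_sum times_differentiable_on_mult) auto
    also have "\<dots> = (\<Sum>d<n. \<Sum>j\<le>q. real (q choose j) *
        ((deriv ^^ j) (y d) t * (deriv ^^ (q - j)) (\<lambda>s. X s $$ (d, c)) t))"
      using x y open_I assms(3) by (intro sum.cong higher_deriv_mult) auto
    also have "\<dots> = (\<Sum>d<n. \<Sum>j\<le>q. real (q choose j) *
        ((\<Sum>e<n. y e t * ?B j $$ (e, d)) * mat_deriv (q - j) X t $$ (d, c)))"
      using less.IH Suc less.prems by (intro sum.cong) (auto simp: D_entry)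
    also have "\<dots> = (\<Sum>d<n. \<Sum>j\<le>q. \<Sum>e<n. y e t *
        (real (q choose j) * (?B j $$ (e, d) * mat_deriv (q - j) X t $$ (d, c))))"
      by (simp add: sum_distrib_left sum_distrib_right mult_ac)
    also have "\<dots> = (\<Sum>d<n. \<Sum>e<n. \<Sum>j\<le>q. y e t *
        (real (q choose j) * (?B j $$ (e, d) * mat_deriv (q - j) X t $$ (d, c))))"
      by (intro sum.cong refl sum.swap)
    also have "\<dots> = (\<Sum>e<n. \<Sum>d<n. \<Sum>j\<le>q. y e t *
        (real (q choose j) * (?B j $$ (e, d) * mat_deriv (q - j) X t $$ (d, c))))"
      by (rule sum.swap)
    also have "\<dots> = (\<Sum>e<n. \<Sum>j\<le>q. \<Sum>d<n. y e t *
        (real (q choose j) * (?B j $$ (e, d) * mat_deriv (q - j) X t $$ (d, c))))"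
      by (intro sum.cong refl sum.swap)
    also have "\<dots> = (\<Sum>e<n. y e t * ?B l $$ (e, c))"
      unfolding Suc using less.prems D_carrier
      by (intro sum.cong refl, subst nc_bell_Suc_entry) (auto simp: sum_distrib_left)
    finally show ?thesis .
  qed
qed

end

section \<open>The companion system\<close>

lemma companion_fun_carrier: "1 \<le> n \<Longrightarrow> companion_fun n a t \<in> carrier_mat n n"
  by (intro carrier_matI) (simp_all add: companion_fun_def)

lemma companion_fun_entry:
  fixes a :: "real \<Rightarrow> real vec"
  assumes "i < n" "c < n"
  shows "companion_fun n a t $$ (i, c) =
    (if c = 0 then a t $ i else if i = c - 1 then 1 else 0)"
  using assms by (cases c) (auto simp: companion_fun_def mat_of_cols_index)

text \<open>
  The derivatives of \<open>y\<close> are listed from order \<open>n - 1\<close> downwards, so differentiating shifts each one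
  to its left neighbour (the unit columns of the companion matrix), and only the first one needs the
  differential equation (the column \<open>a\<close>).
\<close>
lemma companion_linear_system:
  fixes a :: "real \<Rightarrow> real vec"
  assumes "1 \<le> n" "open I"
    and a: "\<And>i. i < n \<Longrightarrow> times_differentiable_on p (\<lambda>t. a t $ i) I"
    and y: "solves_linear_ode n a I y"
  shows "linear_system n p I (companion_fun n a) (\<lambda>c. (deriv ^^ (n - 1 - c)) y)"
proof unfold_locales
  show "open I" by (rule assms(2))
  show "companion_fun n a t \<in> carrier_mat n n" for t
    using assms(1) by (rule companion_fun_carrier)
  show "times_differentiable_on p (\<lambda>s. companion_fun n a s $$ (d, c)) I" if "d < n" "c < n" for d c
  proof (cases "c = 0")
    case True
    then show ?thesis using that a by (simp add: companion_fun_entry)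
  next
    case False
    then show ?thesis
      using that by (simp add: companion_fun_entry times_differentiable_on_const[OF \<open>open I\<close>])
  qed
  fix c t assume c: "c < n" and t: "t \<in> I"
  have eq: "(\<Sum>d<n. (deriv ^^ (n - 1 - d)) y t * companion_fun n a t $$ (d, c)) =
      (deriv ^^ Suc (n - 1 - c)) y t"
  proof (cases "c = 0")
    case True
    have "(\<Sum>d<n. (deriv ^^ (n - 1 - d)) y t * companion_fun n a t $$ (d, c)) =
        (\<Sum>d<n. a t $ d * (deriv ^^ (n - 1 - d)) y t)"
      using c True by (intro sum.cong) (auto simp: companion_fun_entry)
    also have "\<dots> = (deriv ^^ n) y t"
      using y t unfolding solves_linear_ode_def by metis
    also have "\<dots> = (deriv ^^ Suc (n - 1 - c)) y t"
      using c True by (simp del: funpow.simps)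
    finally show ?thesis .
  next
    case False
    have "(\<Sum>d<n. (deriv ^^ (n - 1 - d)) y t * companion_fun n a t $$ (d, c)) =
        (\<Sum>d<n. if d = c - 1 then (deriv ^^ (n - 1 - d)) y t else 0)"
      using c False by (intro sum.cong) (auto simp: companion_fun_entry)
    also have "\<dots> = (deriv ^^ (n - 1 - (c - 1))) y t"
      using c by simp
    also have "n - 1 - (c - 1) = Suc (n - 1 - c)"
      using c False by simp
    finally show ?thesis .
  qed
  have "((deriv ^^ (n - 1 - c)) y has_real_derivative (deriv ^^ Suc (n - 1 - c)) y t) (at t)"
    using y c t by (intro has_deriv_if_times_differentiable_on[where k = n and I = I])
      (auto simp: solves_linear_ode_def)
  from DERIV_cong[OF this eq[symmetric]] show "((deriv ^^ (n - 1 - c)) y has_real_derivative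
      (\<Sum>d<n. (deriv ^^ (n - 1 - d)) y t * companion_fun n a t $$ (d, c))) (at t)" .
qed

theorem theorem4:
  fixes n m :: nat and I :: "real set" and a f :: "real \<Rightarrow> real vec"
    and k :: "nat vec" and l :: "nat \<Rightarrow> nat"
  assumes "n \<ge> 1" and "m \<ge> 1"
    and "open I" and "is_interval I" and "I \<noteq> {}"
    and "\<forall>t\<in>I. a t \<in> carrier_vec n"
    and "\<forall>i<n. times_cont_differentiable_on (m - 1) (\<lambda>t. a t $ i) I"
    and "fundamental_system n a I f"
    and "k \<in> carrier_vec n"
    and "Max (vec_set k) \<le> m + n - 1"
    and "\<forall>i<n. l i = nat (max (int (k $ i) - int n + 1) 0)"
  shows "\<forall>t\<in>I. gen_wronskian n k f t =
    wronskian n f t *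
    det (mat_of_cols n
      (map (\<lambda>i. nc_bell n (l i) (\<lambda>j. mat_deriv (j - 1) (companion_fun n a) t)
                  *\<^sub>v unit_vec n (n + l i - k $ i - 1)) [0..<n]))"
proof
  fix t assume t: "t \<in> I"
  let ?B = "\<lambda>l. nc_bell n l (\<lambda>j. mat_deriv (j - 1) (companion_fun n a) t)"
  let ?F = "mat_of_cols n (map (\<lambda>i. vec_deriv (vec n (\<lambda>i. n - 1 - i) $ i) f t) [0..<n])"
  let ?M = "mat_of_cols n (map (\<lambda>i. ?B (l i) *\<^sub>v unit_vec n (n + l i - k $ i - 1)) [0..<n])"
  have f_dim: "dim_vec (f t) = n"
    using assms(8) t by (auto simp: fundamental_system_def)
  have F_entry: "?F $$ (r, d) = (deriv ^^ (n - 1 - d)) (\<lambda>s. f s $ r) t" if "r < n" "d < n" for r d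
    using that f_dim by (simp add: mat_of_cols_index vec_deriv_def)
  have M_entry: "?M $$ (d, c) = ?B (l c) $$ (d, n + l c - k $ c - 1)"
    if "d < n" "c < n" "n + l c - k $ c - 1 < n" for d c
    using that carrier_matD[OF nc_bell_carrier[of n "l c"]]
    by (simp add: mat_of_cols_index)
  have factor: "mat_of_cols n (map (\<lambda>i. vec_deriv (k $ i) f t) [0..<n]) = ?F * ?M"
  proof (rule eq_matI)
    fix r c assume "r < dim_row (?F * ?M)" "c < dim_col (?F * ?M)"
    then have r: "r < n" and c: "c < n" by auto
    let ?e = "n + l c - k $ c - 1"
    have kc: "k $ c \<le> m + n - 1"
    proof -
      have "k $ c \<in> vec_set k" using assms(9) c by (auto simp: vec_set_def)
      moreover have "finite (vec_set k)" by (simp add: vec_set_def)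
      ultimately show ?thesis using assms(10) Max_ge le_trans by blast
    qed
    have lc: "l c = nat (max (int (k $ c) - int n + 1) 0)" using assms(11) c by simp
    \<comment> \<open>column \<open>?e\<close> (counted from 0) of the \<open>l c\<close>-th derivative of \<open>F\<close> is the \<open>k $ c\<close>-th derivative
        of \<open>f\<close>; for \<open>k $ c \<ge> n\<close> it is the first column\<close>
    have e: "?e < n" "l c \<le> Suc (m - 1)" "l c + (n - 1 - ?e) = k $ c"
      using lc kc \<open>n \<ge> 1\<close> \<open>m \<ge> 1\<close> by auto
    interpret linear_system n "m - 1" I "companion_fun n a" "\<lambda>c. (deriv ^^ (n - 1 - c)) (\<lambda>s. f s $ r)"
      using assms r by (intro companion_linear_system)
        (auto simp: times_cont_differentiable_on_def fundamental_system_def)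
    have "(deriv ^^ (k $ c)) (\<lambda>s. f s $ r) t =
        (deriv ^^ l c) ((deriv ^^ (n - 1 - ?e)) (\<lambda>s. f s $ r)) t"
      using e(3) by (metis funpow_add comp_apply)
    also have "\<dots> = (\<Sum>d<n. (deriv ^^ (n - 1 - d)) (\<lambda>s. f s $ r) t * ?B (l c) $$ (d, ?e))"
      by (rule higher_deriv_of_linear_system[OF e(2) e(1) t])
    also have "\<dots> = (\<Sum>d<n. ?F $$ (r, d) * ?M $$ (d, c))"
      using r c e(1) by (intro sum.cong) (simp_all only: F_entry M_entry lessThan_iff)
    also have "\<dots> = (?F * ?M) $$ (r, c)"
      using r c by (simp add: scalar_prod_def atLeast0LessThan)
    finally show "mat_of_cols n (map (\<lambda>i. vec_deriv (k $ i) f t) [0..<n]) $$ (r, c) = (?F * ?M) $$ (r, c)"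
      using r c f_dim by (simp add: mat_of_cols_index vec_deriv_def)
  qed auto
  have "?F \<in> carrier_mat n n" "?M \<in> carrier_mat n n"
    by (rule carrier_matI; simp)+
  from trans[OF arg_cong[where f = det, OF factor] det_mult[OF this]]
  show "gen_wronskian n k f t = wronskian n f t * det ?M"
    unfolding gen_wronskian_def wronskian_def .
qed

end
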